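(* Consider the linear-Gaussian inverse problem on $\mathcal{H}$ and its $n$-dimensional discretizations described in the context. Assume: (i) there are a constant $r_1\in\mathbb{R}$ and a function $\psi_1:\mathbb{N}\to\mathbb{R}$ with $\lim_{n\to\infty}\psi_1(n)=0$ such that $\|\mathcal{C}_0-P^*C_0P\|_{op}\le r_1\psi_1(n)$; (ii) there are a constant $r_2\in\mathbb{R}$ and a function $\psi_2:\mathbb{N}\to\mathbb{R}$ with $\lim_{n\to\infty}\psi_2(n)=0$ such that $\|\mathcal{F}-FP\|_{op}\le r_2\psi_2(n)$; (iii) there are a Hilbert space $\mathcal{H}'$ continuously embedded in $\mathcal{H}$, a constant $r_3\in\mathbb{R}$ and a function $\psi_3:\mathbb{N}\to\mathbb{R}$ with $\lim_{n\to\infty}\psi_3(n)=0$ such that $\|(I-P^*P)u\|_{\mathcal{H}}\le r_3\psi_3(n)\|u\|_{\mathcal{H}'}$ for every $u\in\mathcal{H}'$. Then the error $\varepsilon_C=\|\mathcal{C}_{\text{post}}-P^*C_{\text{post}}P\|_{op}$ satisfies $$\varepsilon_C\le r_1'\psi_1(n)+r_2'\psi_2(n),$$ where $$r_1'=r_1+2c_1r_1\|\mathcal{F}\|_{op}\|\mathcal{C}_0\|_{op}+2r_1\|\mathcal{F}\|_{op}\|\mathscr{K}(\mathcal{C}_0,\mathcal{F})\|_{op},\qquad r_2'=2c_2r_2\|\mathcal{F}\mathcal{C}_0\|_{op}+r_2\|\mathcal{C}_0\|_{op}\|\mathscr{K}(\mathcal{C}_0,\mathcal{F})\|_{op},$$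 $\mathscr{K}(\mathcal{C},\mathcal{F})=\mathcal{C}\mathcal{F}^*(\mathcal{F}\mathcal{C}\mathcal{F}^*+\Gamma)^{-1}$, and, with $(\mathcal{C}_1,\mathcal{F}_1)=(\mathcal{C}_0,\mathcal{F})$ and $(\mathcal{C}_2,\mathcal{F}_2)=(P^*C_0P,FP)$, $$c_1=\|\Gamma^{-1}\|_{op}\|\mathcal{F}_2\|_{op}+\|\Gamma^{-1}\|_{op}^2\|\mathcal{C}_1\|_{op}\|\mathcal{F}_1\|_{op}\|\mathcal{F}_2\|_{op}^2,$$ $$c_2=\|\Gamma^{-1}\|_{op}\|\mathcal{C}_1\|_{op}+\|\Gamma^{-1}\|_{op}^2\|\mathcal{C}_1\|_{op}^2\|\mathcal{F}_1\|_{op}^2+\|\Gamma^{-1}\|_{op}^2\|\mathcal{C}_1\|_{op}^2\|\mathcal{F}_1\|_{op}\|\mathcal{F}_2\|_{op}.$$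
   Context: Continuum problem: $\mathcal{H}$ is an infinite-dimensional separable real Hilbert space, $\mathcal{F}:\mathcal{H}\to\mathbb{R}^{d_y}$ is linear and bounded, $\Gamma$ is a symmetric positive definite $d_y\times d_y$ matrix, $y\in\mathbb{R}^{d_y}$ is given data, and the prior is the Gaussian measure $\mathcal{N}(m_0,\mathcal{C}_0)$ on $\mathcal{H}$, where $\mathcal{C}_0$ is a trace-class covariance operator and $m_0\in\mathrm{Im}(\mathcal{C}_0^{1/2})$. The posterior for the model $y=\mathcal{F}u+\eta$, $\eta\sim\mathcal{N}(0,\Gamma)$, is Gaussian with covariance $$\mathcal{C}_{\text{post}}=\mathcal{C}_0-\mathcal{C}_0\mathcal{F}^*(\mathcal{F}\mathcal{C}_0\mathcal{F}^*+\Gamma)^{-1}\mathcal{F}\mathcal{C}_0 .$$ Discretization (for each $n\in\mathbb{N}$; dependence on $n$ is suppressed): $\mathcal{V}\subset\mathcal{H}$ is an $n$-dimensional subspace with basis $\phi_1,\dots,\phi_n$; $M_{ij}=\langle\phi_i,\phi_j\rangle_{\mathcal{H}}$; $\mathbb{R}^n_M$ is $\mathbb{R}^n$ with inner product $\langle\vec u,\vec v\rangle_M=\vec u^TM\vec v$. The map $P:\mathcal{H}\to\mathbb{R}^n_M$ sends $u$ to the coefficient vector of the $\mathcal{H}$-orthogonal projection of $u$ onto $\mathcal{V}$, and $P^*:\mathbb{R}^n_M\to\mathcal{V}\subset\mathcal{H}$ is $P^*\vec u=\sum_iu_i\phi_i$ (the adjoint of $P$). $F:\mathbb{R}^n_M\to\mathbb{R}^{d_y}$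 is a linear discretized forward model (a $d_y\times n$ matrix) with adjoint $F^\natural=M^{-1}F^T$; $C_0:\mathbb{R}^n_M\to\mathbb{R}^n_M$ is an invertible covariance operator (self-adjoint and positive definite with respect to $\langle\cdot,\cdot\rangle_M$), and the discretized prior is $\mathcal{N}(Pm_0,C_0)$. The discretized posterior has covariance $$C_{\text{post}}=C_0-C_0F^\natural(FC_0F^\natural+\Gamma)^{-1}FC_0 .$$ $\|\cdot\|_{op}$ is the operator norm between the relevant normed spaces; $\mathbb{R}^{d_y}$ carries the Euclidean norm.
   Formalization: The bound is proved for all sufficiently large n rather than every n, and under the added assumption that the composition of the forward map with the prior covariance is nonzero; without either, explicit counterexamples exist. *)

theory Defs
  imports "HOL-Analysis.Analysis"
begin

section \<open>Operators on a real Hilbert space\<close>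

definition self_adjoint_op :: "('h::real_inner \<Rightarrow> 'h) \<Rightarrow> bool" where
  "self_adjoint_op A \<longleftrightarrow> bounded_linear A \<and> (\<forall>u v. A u \<bullet> v = u \<bullet> A v)"

definition nonneg_op :: "('h::real_inner \<Rightarrow> 'h) \<Rightarrow> bool" where
  "nonneg_op A \<longleftrightarrow> self_adjoint_op A \<and> (\<forall>u. 0 \<le> A u \<bullet> u)"

definition op_sqrt :: "('h::real_inner \<Rightarrow> 'h) \<Rightarrow> ('h \<Rightarrow> 'h)" where
  "op_sqrt A = (THE S. nonneg_op S \<and> S \<circ> S = A)"

definition orthonormal_basis :: "'h::real_inner set \<Rightarrow> bool" where
  "orthonormal_basis E \<longleftrightarrow>
     pairwise orthogonal E \<and> (\<forall>e\<in>E. norm e = 1) \<and> closure (span E) = UNIV"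

definition trace_class :: "('h::real_inner \<Rightarrow> 'h) \<Rightarrow> bool" where
  "trace_class A \<longleftrightarrow> bounded_linear A \<and>
     (\<exists>E. orthonormal_basis E \<and> (\<lambda>e. op_sqrt (adjoint A \<circ> A) e \<bullet> e) summable_on E)"

text \<open>These are exactly the covariance operators of the Gaussian measures on a separable
  Hilbert space; a Gaussian measure is determined by its mean and its covariance operator.\<close>

definition covariance_op :: "('h::real_inner \<Rightarrow> 'h) \<Rightarrow> bool" where
  "covariance_op C \<longleftrightarrow> nonneg_op C \<and> trace_class C"

definition spd_matrix :: "real ^ 'd ^ 'd \<Rightarrow> bool" where
  "spd_matrix \<Gamma> \<longleftrightarrow> transpose \<Gamma> = \<Gamma> \<and> (\<forall>z. z \<noteq> 0 \<longrightarrow> 0 < z \<bullet> (\<Gamma> *v z))"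

definition orth_proj :: "'h::real_inner set \<Rightarrow> 'h \<Rightarrow> 'h" where
  "orth_proj V u = (THE v. v \<in> V \<and> (\<forall>w\<in>V. (u - v) \<bullet> w = 0))"


section \<open>Gain and posterior covariance\<close>

text \<open>Both are stated for an arbitrary space \<open>'v\<close>, with the adjoint \<open>Fadj\<close> of \<open>F\<close> as an explicit
  argument, so that one formula serves the Hilbert space (with \<^const>\<open>adjoint\<close>) and the coefficient
  space, whose adjoint depends on the mass matrix.  For symmetric positive definite \<open>\<Gamma>\<close> and a
  covariance \<open>C\<close> the map under \<^const>\<open>inv\<close> is bijective.\<close>

definition gain ::
  "real ^ 'd ^ 'd \<Rightarrow> ('v \<Rightarrow> 'v) \<Rightarrow> ('v \<Rightarrow> real ^ 'd) \<Rightarrow> (real ^ 'd \<Rightarrow> 'v) \<Rightarrow> real ^ 'd \<Rightarrow> 'v" where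
  "gain \<Gamma> C F Fadj z = C (Fadj (inv (\<lambda>w. F (C (Fadj w)) + \<Gamma> *v w) z))"

definition post_cov ::
  "real ^ 'd ^ 'd \<Rightarrow> ('v \<Rightarrow> 'v) \<Rightarrow> ('v \<Rightarrow> real ^ 'd) \<Rightarrow> (real ^ 'd \<Rightarrow> 'v) \<Rightarrow> 'v::minus \<Rightarrow> 'v" where
  "post_cov \<Gamma> C F Fadj u = C u - gain \<Gamma> C F Fadj (F (C u))"


section \<open>Coefficient space with mass-weighted inner product\<close>

text \<open>A vector of \<open>\<real>\<^sup>n\<close> is a function \<open>nat \<Rightarrow> real\<close> of which only the entries with index \<open>< n\<close>
  count (all operations below return \<open>0\<close> elsewhere); likewise for matrices.  Here
  \<open>\<phi> :: nat \<Rightarrow> 'h\<close> is the basis \<open>\<phi> 0, \<dots>, \<phi> (n - 1)\<close> of one fixed \<open>n\<close>-dimensional subspace.\<close>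

definition mass :: "(nat \<Rightarrow> 'h::real_inner) \<Rightarrow> nat \<Rightarrow> nat \<Rightarrow> real" where
  "mass \<phi> i j = \<phi> i \<bullet> \<phi> j"

definition mass_inner ::
  "(nat \<Rightarrow> 'h::real_inner) \<Rightarrow> nat \<Rightarrow> (nat \<Rightarrow> real) \<Rightarrow> (nat \<Rightarrow> real) \<Rightarrow> real" where
  "mass_inner \<phi> n c d = (\<Sum>i<n. \<Sum>j<n. c i * mass \<phi> i j * d j)"

definition mat_vec :: "nat \<Rightarrow> (nat \<Rightarrow> nat \<Rightarrow> real) \<Rightarrow> (nat \<Rightarrow> real) \<Rightarrow> (nat \<Rightarrow> real)" where
  "mat_vec n A c = (\<lambda>i. if i < n then \<Sum>j<n. A i j * c j else 0)"

definition mat_inverse_n :: "nat \<Rightarrow> (nat \<Rightarrow> nat \<Rightarrow> real) \<Rightarrow> (nat \<Rightarrow> nat \<Rightarrow> real)" where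
  "mat_inverse_n n A = (THE B. (\<forall>i j. i \<ge> n \<or> j \<ge> n \<longrightarrow> B i j = 0) \<and>
     (\<forall>i<n. \<forall>j<n. (\<Sum>k<n. A i k * B k j) = of_bool (i = j) \<and>
                  (\<Sum>k<n. B i k * A k j) = of_bool (i = j)))"

text \<open>Positive definiteness entails that the matrix is invertible.\<close>

definition mass_spd :: "(nat \<Rightarrow> 'h::real_inner) \<Rightarrow> nat \<Rightarrow> (nat \<Rightarrow> nat \<Rightarrow> real) \<Rightarrow> bool" where
  "mass_spd \<phi> n C \<longleftrightarrow>
     (\<forall>c d. mass_inner \<phi> n (mat_vec n C c) d = mass_inner \<phi> n c (mat_vec n C d)) \<and>
     (\<forall>c. (\<exists>i<n. c i \<noteq> 0) \<longrightarrow> 0 < mass_inner \<phi> n c (mat_vec n C c))"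

text \<open>\<open>Pstar\<close> and \<open>Pcoef\<close> are the maps \<open>P\<^sup>*\<close> and \<open>P\<close>.\<close>

definition Pstar :: "(nat \<Rightarrow> 'h::real_inner) \<Rightarrow> nat \<Rightarrow> (nat \<Rightarrow> real) \<Rightarrow> 'h" where
  "Pstar \<phi> n c = (\<Sum>i<n. c i *\<^sub>R \<phi> i)"

definition Pcoef :: "(nat \<Rightarrow> 'h::real_inner) \<Rightarrow> nat \<Rightarrow> 'h \<Rightarrow> (nat \<Rightarrow> real)" where
  "Pcoef \<phi> n u = (THE c. (\<forall>i\<ge>n. c i = 0) \<and> Pstar \<phi> n c = orth_proj (span (\<phi> ` {..<n})) u)"

text \<open>The discretized forward map is a \<open>d\<^sub>y \<times> n\<close> matrix \<open>A\<close>, with rows indexed by \<open>'d\<close>;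
  \<open>fwd_nat\<close> is its adjoint \<open>M\<^sup>-\<^sup>1 A\<^sup>T\<close> for the mass inner product.\<close>

definition fwd :: "nat \<Rightarrow> ('d::finite \<Rightarrow> nat \<Rightarrow> real) \<Rightarrow> (nat \<Rightarrow> real) \<Rightarrow> real ^ 'd" where
  "fwd n A c = (\<chi> a. \<Sum>j<n. A a j * c j)"

definition fwd_nat ::
  "(nat \<Rightarrow> 'h::real_inner) \<Rightarrow> nat \<Rightarrow> ('d::finite \<Rightarrow> nat \<Rightarrow> real) \<Rightarrow> real ^ 'd \<Rightarrow> (nat \<Rightarrow> real)" where
  "fwd_nat \<phi> n A z = mat_vec n (mat_inverse_n n (mass \<phi>)) (\<lambda>j. \<Sum>a\<in>UNIV. A a j * z $ a)"


section \<open>Constants of the error bound\<close>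

definition c1_const ::
  "real ^ 'd ^ 'd \<Rightarrow> ('h::real_inner \<Rightarrow> 'h) \<Rightarrow> ('h \<Rightarrow> real ^ 'd) \<Rightarrow> ('h \<Rightarrow> real ^ 'd) \<Rightarrow> real" where
  "c1_const \<Gamma> C\<^sub>1 F\<^sub>1 F\<^sub>2 = (let g = onorm ((*v) (matrix_inv \<Gamma>)) in
     g * onorm F\<^sub>2 + g\<^sup>2 * onorm C\<^sub>1 * onorm F\<^sub>1 * (onorm F\<^sub>2)\<^sup>2)"

definition c2_const ::
  "real ^ 'd ^ 'd \<Rightarrow> ('h::real_inner \<Rightarrow> 'h) \<Rightarrow> ('h \<Rightarrow> real ^ 'd) \<Rightarrow> ('h \<Rightarrow> real ^ 'd) \<Rightarrow> real" where
  "c2_const \<Gamma> C\<^sub>1 F\<^sub>1 F\<^sub>2 = (let g = onorm ((*v) (matrix_inv \<Gamma>)) in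
     g * onorm C\<^sub>1 + g\<^sup>2 * (onorm C\<^sub>1)\<^sup>2 * (onorm F\<^sub>1)\<^sup>2
       + g\<^sup>2 * (onorm C\<^sub>1)\<^sup>2 * onorm F\<^sub>1 * onorm F\<^sub>2)"

end

theory Submission
  imports Defs
begin

text \<open>The lift of the discretized posterior to \<open>\<H>\<close> is the posterior of the lifted pair
  \<open>(C\<^sub>2, F\<^sub>2) = (P\<^sup>* C\<^sub>0 P, F P)\<close>, so both posteriors are compared on \<open>\<H>\<close>.  With
  \<open>G\<^sub>i = F\<^sub>i C\<^sub>i F\<^sub>i\<^sup>* + \<Gamma> \<ge> \<Gamma>\<close> the inverses have norm at most that of the inverse of \<open>\<Gamma>\<close>, and
  \<open>G\<^sub>1\<close> inverse minus \<open>G\<^sub>2\<close> inverse is controlled by \<open>G\<^sub>2 - G\<^sub>1\<close>, which yields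
  \<open>\<parallel>K\<^sub>1 - K\<^sub>2\<parallel> \<le> c\<^sub>1 \<parallel>C\<^sub>1 - C\<^sub>2\<parallel> + c\<^sub>2 \<parallel>F\<^sub>1 - F\<^sub>2\<parallel>\<close> for the gains.  The bound then follows from
  \<open>K\<^sub>1 F\<^sub>1 C\<^sub>1 - K\<^sub>2 F\<^sub>2 C\<^sub>2 = (K\<^sub>1 - K\<^sub>2) F\<^sub>2 C\<^sub>2 + K\<^sub>1 ((F\<^sub>1 - F\<^sub>2) C\<^sub>1 + F\<^sub>2 (C\<^sub>1 - C\<^sub>2))\<close>; the factors 2
  absorb \<open>\<parallel>F\<^sub>2\<parallel>\<close> and \<open>\<parallel>F\<^sub>2 C\<^sub>2\<parallel>\<close>, which converge to \<open>\<parallel>F\<^sub>1\<parallel>\<close> and \<open>\<parallel>F\<^sub>1 C\<^sub>1\<parallel>\<close>, both nonzero.\<close>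

section \<open>Perturbation of the posterior covariance\<close>

lemma spd_matrix_inv_right:
  assumes "spd_matrix \<Gamma>"
  shows "\<Gamma> *v (matrix_inv \<Gamma> *v z) = z"
proof -
  have "w = 0" if "\<Gamma> *v w = 0" for w
    using assms that unfolding spd_matrix_def by (metis inner_zero_right less_irrefl)
  then have "invertible \<Gamma>"
    by (simp add: invertible_left_inverse matrix_left_invertible_ker)
  then have "\<Gamma> ** matrix_inv \<Gamma> = mat 1"
    unfolding invertible_def matrix_inv_def by (rule someI2_ex) simp
  then show ?thesis
    by (simp add: matrix_vector_mul_assoc)
qed

text \<open>With \<open>s\<close> the image of \<open>w\<close> under the inverse, expand the
  nonnegative quadratic form of \<open>\<Gamma>\<close> at \<open>g *\<^sub>R w - s\<close>. This
  bounds the smallest eigenvalue of \<open>\<Gamma>\<close> from below by \<open>1 / g\<close>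
  without a spectral decomposition.\<close>

lemma spd_matrix_lower_bound:
  assumes "spd_matrix \<Gamma>"
  shows "(norm w)\<^sup>2 \<le> onorm ((*v) (matrix_inv \<Gamma>)) * (w \<bullet> (\<Gamma> *v w))"
proof (cases "w = 0")
  case False
  define g where "g = onorm ((*v) (matrix_inv \<Gamma>))"
  define s where "s = matrix_inv \<Gamma> *v w"
  have sym: "x \<bullet> (\<Gamma> *v y) = y \<bullet> (\<Gamma> *v x)" for x y
    using assms unfolding spd_matrix_def
    by (metis dot_lmul_matrix inner_commute transpose_matrix_vector)
  have nn: "0 \<le> x \<bullet> (\<Gamma> *v x)" for x
    using assms unfolding spd_matrix_def by (cases "x = 0") (auto intro: less_imp_le)
  have Gs: "\<Gamma> *v s = w"
    unfolding s_def by (rule spd_matrix_inv_right[OF assms])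
  have ns: "norm s \<le> g * norm w"
    unfolding s_def g_def by (intro onorm matrix_vector_mul_bounded_linear)
  \<comment> \<open>Strict positivity of \<open>g\<close> is what allows cancelling the factor
    \<open>g\<close> at the end.\<close>
  have "s \<noteq> 0" using Gs False by auto
  then have "0 < g * norm w" using ns by (meson less_le_trans zero_less_norm_iff)
  then have g: "0 < g" using zero_less_mult_pos2 False by fastforce
  have "s \<bullet> w \<le> norm s * norm w" by (rule norm_cauchy_schwarz)
  also have "\<dots> \<le> g * (norm w)\<^sup>2"
    using mult_right_mono[OF ns, of "norm w"] by (simp add: power2_eq_square mult.assoc)
  finally have sw: "s \<bullet> w \<le> g * (norm w)\<^sup>2" .
  have "0 \<le> (g *\<^sub>R w - s) \<bullet> (\<Gamma> *v (g *\<^sub>R w - s))" by (rule nn)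
  also have "\<dots> = g\<^sup>2 * (w \<bullet> (\<Gamma> *v w)) - 2 * g * (norm w)\<^sup>2 + s \<bullet> w"
    using sym[of s w]
    by (simp add: matrix_vector_mult_diff_distrib matrix_vector_mult_scaleR Gs inner_diff_left
        inner_diff_right power2_eq_square inner_commute algebra_simps)
      (simp add: power2_eq_square flip: power2_norm_eq_inner)
  also have "\<dots> \<le> g * (g * (w \<bullet> (\<Gamma> *v w)) - (norm w)\<^sup>2)"
    using sw by (simp add: algebra_simps power2_eq_square)
  finally show ?thesis
    using g by (simp add: g_def[symmetric] zero_le_mult_iff)
qed simp

text \<open>Paired with \<open>w\<close>, the prior term contributes
  \<open>C (A w) \<bullet> A w\<close>, which is nonnegative, so the coercivity of
  \<open>\<Gamma>\<close> survives; Cauchy-Schwarz turns it into a norm bound. It serves both for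
  injectivity and for a bound on the inverse that is uniform in \<open>C\<close> and
  \<open>F\<close>.\<close>

lemma innovation_lower_bound:
  fixes C :: "'h::real_inner \<Rightarrow> 'h" and F :: "'h \<Rightarrow> real ^ 'd"
  assumes \<Gamma>: "spd_matrix \<Gamma>" and C: "\<And>u. 0 \<le> C u \<bullet> u"
    and adj: "\<And>u z. F u \<bullet> z = u \<bullet> A z"
  shows "norm w \<le> onorm ((*v) (matrix_inv \<Gamma>)) * norm (F (C (A w)) + \<Gamma> *v w)"
proof (cases "w = 0")
  case False
  let ?g = "onorm ((*v) (matrix_inv \<Gamma>))" and ?G = "F (C (A w)) + \<Gamma> *v w"
  have g: "0 \<le> ?g" by (intro onorm_pos_le matrix_vector_mul_bounded_linear)
  have "w \<bullet> (\<Gamma> *v w) \<le> w \<bullet> ?G"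
    using C[of "A w"] adj[of "C (A w)" w] by (simp add: inner_add_right inner_commute)
  also have "\<dots> \<le> norm w * norm ?G" by (rule norm_cauchy_schwarz)
  finally have "?g * (w \<bullet> (\<Gamma> *v w)) \<le> ?g * (norm w * norm ?G)"
    using g by (rule mult_left_mono)
  with spd_matrix_lower_bound[OF \<Gamma>, of w]
  have "norm w * norm w \<le> norm w * (?g * norm ?G)"
    by (simp add: power2_eq_square algebra_simps)
  then show ?thesis using False by simp
next
  case True
  have "0 \<le> onorm ((*v) (matrix_inv \<Gamma>))" by (intro onorm_pos_le matrix_vector_mul_bounded_linear)
  then show ?thesis using True by simp
qed

text \<open>The adjoint relation determines \<open>A\<close> pointwise, which forces linearity;
  boundedness is automatic on the finite-dimensional domain.\<close>

lemma adjoint_bounded_linear: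
  fixes F :: "'h::real_inner \<Rightarrow> real ^ 'd"
  assumes adj: "\<And>u z. F u \<bullet> z = u \<bullet> A z"
  shows "bounded_linear A"
proof -
  have "linear A"
  proof (rule linearI)
    show "A (x + y) = A x + A y" for x y
      by (rule vector_eq_rdot[THEN iffD1]) (simp add: inner_add_right inner_commute flip: adj)
    show "A (c *\<^sub>R x) = c *\<^sub>R A x" for c x
      by (rule vector_eq_rdot[THEN iffD1]) (simp add: inner_commute flip: adj)
  qed
  then show ?thesis by (simp add: linear_conv_bounded_linear)
qed

text \<open>Test the adjoint relation at \<open>u = A z\<close> and cancel one factor
  \<open>norm (A z)\<close>.\<close>

lemma norm_adjoint_le:
  fixes F :: "'h::real_inner \<Rightarrow> real ^ 'd"
  assumes "bounded_linear F" and adj: "\<And>u z. F u \<bullet> z = u \<bullet> A z"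
  shows "norm (A z) \<le> onorm F * norm z"
proof (cases "A z = 0")
  case False
  have "norm (A z) * norm (A z) = F (A z) \<bullet> z"
    by (simp add: adj norm_eq_sqrt_inner)
  also have "\<dots> \<le> norm (F (A z)) * norm z" by (rule norm_cauchy_schwarz)
  also have "\<dots> \<le> (onorm F * norm (A z)) * norm z"
    by (intro mult_right_mono onorm assms) simp
  finally have "norm (A z) * norm (A z) \<le> norm (A z) * (onorm F * norm z)"
    by (simp add: algebra_simps)
  then show ?thesis using False by simp
qed (simp add: onorm_pos_le assms)

text \<open>The lower bound gives a trivial kernel, and an injective endomorphism of a
  finite-dimensional space is onto. Hence \<open>inv\<close> in \<open>gain\<close> is a genuine
  inverse.\<close>

lemma innovation_linear_bij:
  fixes C :: "'h::real_inner \<Rightarrow> 'h" and F :: "'h \<Rightarrow> real ^ 'd"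
  assumes \<Gamma>: "spd_matrix \<Gamma>" and C: "bounded_linear C" "\<And>u. 0 \<le> C u \<bullet> u"
    and F: "bounded_linear F" and adj: "\<And>u z. F u \<bullet> z = u \<bullet> A z"
  defines "G \<equiv> \<lambda>w. F (C (A w)) + \<Gamma> *v w"
  shows "linear G" "bij G"
proof -
  have A: "bounded_linear A" by (rule adjoint_bounded_linear[OF adj])
  have "bounded_linear (\<lambda>w. F (C (A w)) + \<Gamma> *v w)"
    by (intro bounded_linear_add bounded_linear_compose[OF F] bounded_linear_compose[OF C(1)] A
        matrix_vector_mul_bounded_linear)
  then show lin: "linear G"
    unfolding G_def by (rule bounded_linear.linear)
  have "w = 0" if "G w = 0" for w
    using innovation_lower_bound[OF \<Gamma> C(2) adj, of w] that by (simp add: G_def)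
  then have "inj G" using lin by (simp add: linear_injective_0)
  then show "bij G"
    using lin by (simp add: bij_def linear_injective_imp_surjective)
qed

lemma onorm_le_mult: "bounded_linear f \<Longrightarrow> norm x \<le> y \<Longrightarrow> norm (f x) \<le> onorm f * y"
  by (meson mult_left_mono onorm onorm_pos_le order_trans)

section \<open>Perturbation of the gain and of the posterior covariance\<close>

lemma gain_bounded_linear:
  fixes C :: "'h::real_inner \<Rightarrow> 'h" and F :: "'h \<Rightarrow> real ^ 'd"
  assumes \<Gamma>: "spd_matrix \<Gamma>" and C: "bounded_linear C" "\<And>u. 0 \<le> C u \<bullet> u"
    and F: "bounded_linear F" and adj: "\<And>u z. F u \<bullet> z = u \<bullet> A z"
  shows "bounded_linear (gain \<Gamma> C F A)"
proof -
  note G = innovation_linear_bij[OF \<Gamma> C F adj]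
  have "linear (inv (\<lambda>w. F (C (A w)) + \<Gamma> *v w))"
    using G by (intro inj_linear_imp_inv_linear bij_is_inj)
  then have "bounded_linear (inv (\<lambda>w. F (C (A w)) + \<Gamma> *v w))"
    by (simp add: linear_conv_bounded_linear)
  then show ?thesis
    unfolding gain_def
    by (intro bounded_linear_compose[OF C(1)] bounded_linear_compose[OF adjoint_bounded_linear[OF adj]])
qed

text \<open>Compare the solutions \<open>w\<^sub>1\<close>, \<open>w\<^sub>2\<close> of
  \<open>G\<^sub>i w\<^sub>i = z\<close> and telescope both products so that
  \<open>C\<^sub>2\<close> enters only through \<open>C\<^sub>1 - C\<^sub>2\<close>. This is why the
  constants contain the norm of \<open>C\<^sub>1\<close> but not that of
  \<open>C\<^sub>2\<close>.\<close>

lemma gain_perturbation: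
  fixes C\<^sub>1 C\<^sub>2 :: "'h::real_inner \<Rightarrow> 'h" and F\<^sub>1 F\<^sub>2 :: "'h \<Rightarrow> real ^ 'd"
  assumes \<Gamma>: "spd_matrix \<Gamma>"
    and C1: "bounded_linear C\<^sub>1" "\<And>u. 0 \<le> C\<^sub>1 u \<bullet> u"
    and C2: "bounded_linear C\<^sub>2" "\<And>u. 0 \<le> C\<^sub>2 u \<bullet> u"
    and F1: "bounded_linear F\<^sub>1" and adj1: "\<And>u z. F\<^sub>1 u \<bullet> z = u \<bullet> A\<^sub>1 z"
    and F2: "bounded_linear F\<^sub>2" and adj2: "\<And>u z. F\<^sub>2 u \<bullet> z = u \<bullet> A\<^sub>2 z"
  shows "norm (gain \<Gamma> C\<^sub>1 F\<^sub>1 A\<^sub>1 z - gain \<Gamma> C\<^sub>2 F\<^sub>2 A\<^sub>2 z)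
    \<le> (c1_const \<Gamma> C\<^sub>1 F\<^sub>1 F\<^sub>2 * onorm (\<lambda>u. C\<^sub>1 u - C\<^sub>2 u)
        + c2_const \<Gamma> C\<^sub>1 F\<^sub>1 F\<^sub>2 * onorm (\<lambda>u. F\<^sub>1 u - F\<^sub>2 u)) * norm z"
proof -
  define G\<^sub>1 where "G\<^sub>1 = (\<lambda>w. F\<^sub>1 (C\<^sub>1 (A\<^sub>1 w)) + \<Gamma> *v w)"
  define G\<^sub>2 where "G\<^sub>2 = (\<lambda>w. F\<^sub>2 (C\<^sub>2 (A\<^sub>2 w)) + \<Gamma> *v w)"
  define g where "g = onorm ((*v) (matrix_inv \<Gamma>))"
  define w\<^sub>1 where "w\<^sub>1 = inv G\<^sub>1 z"
  define w\<^sub>2 where "w\<^sub>2 = inv G\<^sub>2 z"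
  define a where "a = onorm (\<lambda>u. C\<^sub>1 u - C\<^sub>2 u)"
  define b where "b = onorm (\<lambda>u. F\<^sub>1 u - F\<^sub>2 u)"
  define N where "N = g * norm z"
  note G1 = innovation_linear_bij[OF \<Gamma> C1 F1 adj1, folded G\<^sub>1_def]
    and G2 = innovation_linear_bij[OF \<Gamma> C2 F2 adj2, folded G\<^sub>2_def]
  have dC: "bounded_linear (\<lambda>u. C\<^sub>1 u - C\<^sub>2 u)" and dF: "bounded_linear (\<lambda>u. F\<^sub>1 u - F\<^sub>2 u)"
    by (intro bounded_linear_sub C1 C2 F1 F2)+
  note A1 = adjoint_bounded_linear[OF adj1] and A2 = adjoint_bounded_linear[OF adj2]
  note lin = bounded_linear.linear[THEN linear_diff] bounded_linear.linear[THEN linear_add]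
  have g: "0 \<le> g" unfolding g_def by (intro onorm_pos_le matrix_vector_mul_bounded_linear)
  have Gw: "G\<^sub>1 w\<^sub>1 = z" "G\<^sub>2 w\<^sub>2 = z"
    unfolding w\<^sub>1_def w\<^sub>2_def using G1 G2 by (simp_all add: bij_is_surj surj_f_inv_f)
  have w2: "norm w\<^sub>2 \<le> N"
    using innovation_lower_bound[OF \<Gamma> C2(2) adj2, of w\<^sub>2] Gw by (simp add: G\<^sub>2_def g_def N_def)
  have Aw: "norm (A\<^sub>2 w\<^sub>2) \<le> onorm F\<^sub>2 * N"
    using norm_adjoint_le[OF F2 adj2] mult_left_mono[OF w2 onorm_pos_le[OF F2]]
    by (rule order_trans)
  \<comment> \<open>The difference of the adjoints is the adjoint of
    \<open>F\<^sub>1 - F\<^sub>2\<close>, so the adjoint bound applies to it directly.\<close>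
  have "norm ((\<lambda>z. A\<^sub>1 z - A\<^sub>2 z) w\<^sub>2) \<le> b * norm w\<^sub>2"
    unfolding b_def by (intro norm_adjoint_le dF) (simp add: inner_diff adj1 adj2)
  also have "\<dots> \<le> b * N"
    unfolding b_def by (intro mult_left_mono w2 onorm_pos_le dF)
  finally have dA: "norm (A\<^sub>1 w\<^sub>2 - A\<^sub>2 w\<^sub>2) \<le> b * N" by simp
  \<comment> \<open>Resolvent identity: both \<open>G\<^sub>1 w\<^sub>1\<close> and
    \<open>G\<^sub>2 w\<^sub>2\<close> equal \<open>z\<close>. The terms in \<open>\<Gamma>\<close>
    then cancel.\<close>
  have "G\<^sub>1 (w\<^sub>1 - w\<^sub>2) = G\<^sub>2 w\<^sub>2 - G\<^sub>1 w\<^sub>2"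
    using Gw G1(1) by (simp add: linear_diff)
  also have "\<dots> = - (F\<^sub>1 (C\<^sub>1 (A\<^sub>1 w\<^sub>2 - A\<^sub>2 w\<^sub>2))
      + (\<lambda>u. F\<^sub>1 u - F\<^sub>2 u) (C\<^sub>1 (A\<^sub>2 w\<^sub>2)) + F\<^sub>2 ((\<lambda>u. C\<^sub>1 u - C\<^sub>2 u) (A\<^sub>2 w\<^sub>2)))"
    by (simp add: G\<^sub>1_def G\<^sub>2_def lin[OF C1(1)] lin[OF F1] lin[OF F2])
  finally have "norm (G\<^sub>1 (w\<^sub>1 - w\<^sub>2)) \<le> onorm F\<^sub>1 * (onorm C\<^sub>1 * (b * N))
      + b * (onorm C\<^sub>1 * (onorm F\<^sub>2 * N)) + onorm F\<^sub>2 * (a * (onorm F\<^sub>2 * N))"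
    unfolding a_def b_def
    by (simp only: norm_minus_cancel)
      (intro norm_triangle_mono onorm_le_mult F1 F2 C1 dC dF Aw dA[unfolded b_def])
  then have dw: "norm (w\<^sub>1 - w\<^sub>2) \<le> g * (onorm F\<^sub>1 * (onorm C\<^sub>1 * (b * N))
      + b * (onorm C\<^sub>1 * (onorm F\<^sub>2 * N)) + onorm F\<^sub>2 * (a * (onorm F\<^sub>2 * N)))" (is "_ \<le> ?D")
    using innovation_lower_bound[OF \<Gamma> C1(2) adj1, of "w\<^sub>1 - w\<^sub>2"] mult_left_mono[OF _ g]
    unfolding G\<^sub>1_def g_def by (meson order_trans)
  have Adw: "norm (A\<^sub>1 (w\<^sub>1 - w\<^sub>2)) \<le> onorm F\<^sub>1 * ?D"
    using norm_adjoint_le[OF F1 adj1] mult_left_mono[OF dw onorm_pos_le[OF F1]]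
    by (rule order_trans)
  have "gain \<Gamma> C\<^sub>1 F\<^sub>1 A\<^sub>1 z - gain \<Gamma> C\<^sub>2 F\<^sub>2 A\<^sub>2 z
      = C\<^sub>1 (A\<^sub>1 (w\<^sub>1 - w\<^sub>2)) + C\<^sub>1 (A\<^sub>1 w\<^sub>2 - A\<^sub>2 w\<^sub>2) + (\<lambda>u. C\<^sub>1 u - C\<^sub>2 u) (A\<^sub>2 w\<^sub>2)"
    by (simp add: gain_def w\<^sub>1_def w\<^sub>2_def G\<^sub>1_def G\<^sub>2_def lin[OF C1(1)] lin[OF A1])
  also have "norm \<dots> \<le> onorm C\<^sub>1 * (onorm F\<^sub>1 * ?D) + onorm C\<^sub>1 * (b * N) + a * (onorm F\<^sub>2 * N)"
    unfolding a_def
    by (intro norm_triangle_mono onorm_le_mult C1 dC Aw dA Adw[unfolded a_def])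
  \<comment> \<open>Collecting the coefficients of \<open>a\<close> and of \<open>b\<close>, with
    one factor \<open>g\<close> hidden in \<open>N\<close>, produces exactly the two
    constants.\<close>
  also have "\<dots> = (c1_const \<Gamma> C\<^sub>1 F\<^sub>1 F\<^sub>2 * a + c2_const \<Gamma> C\<^sub>1 F\<^sub>1 F\<^sub>2 * b) * norm z"
    by (simp add: c1_const_def c2_const_def Let_def N_def flip: g_def)
      (simp add: algebra_simps power2_eq_square)
  finally show ?thesis by (simp add: a_def b_def)
qed

lemma c_const_nonneg:
  assumes "bounded_linear C\<^sub>1" "bounded_linear F\<^sub>1" "bounded_linear F\<^sub>2"
  shows "0 \<le> c1_const \<Gamma> C\<^sub>1 F\<^sub>1 F\<^sub>2" "0 \<le> c2_const \<Gamma> C\<^sub>1 F\<^sub>1 F\<^sub>2"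
  using assms unfolding c1_const_def c2_const_def Let_def
  by (auto intro!: add_nonneg_nonneg mult_nonneg_nonneg onorm_pos_le matrix_vector_mul_bounded_linear)

text \<open>The gain difference is applied to \<open>F\<^sub>2 (C\<^sub>2 u)\<close>, so that every
  other term carries only the exact gain. No smallness enters yet: the norms of
  \<open>F\<^sub>2\<close> and of \<open>F\<^sub>2\<close> after \<open>C\<^sub>2\<close> are left
  as they are.\<close>

lemma post_cov_perturbation:
  fixes C\<^sub>1 C\<^sub>2 :: "'h::real_inner \<Rightarrow> 'h" and F\<^sub>1 F\<^sub>2 :: "'h \<Rightarrow> real ^ 'd"
  assumes \<Gamma>: "spd_matrix \<Gamma>"
    and C1: "bounded_linear C\<^sub>1" "\<And>u. 0 \<le> C\<^sub>1 u \<bullet> u"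
    and C2: "bounded_linear C\<^sub>2" "\<And>u. 0 \<le> C\<^sub>2 u \<bullet> u"
    and F1: "bounded_linear F\<^sub>1" and adj1: "\<And>u z. F\<^sub>1 u \<bullet> z = u \<bullet> A\<^sub>1 z"
    and F2: "bounded_linear F\<^sub>2" and adj2: "\<And>u z. F\<^sub>2 u \<bullet> z = u \<bullet> A\<^sub>2 z"
  defines "a \<equiv> onorm (\<lambda>u. C\<^sub>1 u - C\<^sub>2 u)" and "b \<equiv> onorm (\<lambda>u. F\<^sub>1 u - F\<^sub>2 u)"
  shows "onorm (\<lambda>u. post_cov \<Gamma> C\<^sub>1 F\<^sub>1 A\<^sub>1 u - post_cov \<Gamma> C\<^sub>2 F\<^sub>2 A\<^sub>2 u)
    \<le> a + (c1_const \<Gamma> C\<^sub>1 F\<^sub>1 F\<^sub>2 * a + c2_const \<Gamma> C\<^sub>1 F\<^sub>1 F\<^sub>2 * b) * onorm (\<lambda>u. F\<^sub>2 (C\<^sub>2 u))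
      + onorm (gain \<Gamma> C\<^sub>1 F\<^sub>1 A\<^sub>1) * (b * onorm C\<^sub>1 + onorm F\<^sub>2 * a)" (is "_ \<le> ?R")
proof -
  have dC: "bounded_linear (\<lambda>u. C\<^sub>1 u - C\<^sub>2 u)" and dF: "bounded_linear (\<lambda>u. F\<^sub>1 u - F\<^sub>2 u)"
    by (intro bounded_linear_sub C1 C2 F1 F2)+
  have FC: "bounded_linear (\<lambda>u. F\<^sub>2 (C\<^sub>2 u))"
    by (rule bounded_linear_compose[OF F2 C2(1)])
  note K = gain_bounded_linear[OF \<Gamma> C1 F1 adj1]
  note lin = bounded_linear.linear[THEN linear_diff] bounded_linear.linear[THEN linear_add]
  note nn = onorm_pos_le[OF dC, folded a_def] onorm_pos_le[OF dF, folded b_def]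
    c_const_nonneg[OF C1(1) F1 F2]
  let ?c = "c1_const \<Gamma> C\<^sub>1 F\<^sub>1 F\<^sub>2 * a + c2_const \<Gamma> C\<^sub>1 F\<^sub>1 F\<^sub>2 * b"
  have c: "0 \<le> ?c" by (intro add_nonneg_nonneg mult_nonneg_nonneg nn)
  show ?thesis
  proof (rule onorm_bound)
    show "0 \<le> ?R"
      by (intro add_nonneg_nonneg mult_nonneg_nonneg onorm_pos_le nn FC K C1 F2)
    fix u
    have "norm (post_cov \<Gamma> C\<^sub>1 F\<^sub>1 A\<^sub>1 u - post_cov \<Gamma> C\<^sub>2 F\<^sub>2 A\<^sub>2 u)
        = norm ((\<lambda>u. C\<^sub>1 u - C\<^sub>2 u) u
          + - (gain \<Gamma> C\<^sub>1 F\<^sub>1 A\<^sub>1 (F\<^sub>2 (C\<^sub>2 u)) - gain \<Gamma> C\<^sub>2 F\<^sub>2 A\<^sub>2 (F\<^sub>2 (C\<^sub>2 u)))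
          + - gain \<Gamma> C\<^sub>1 F\<^sub>1 A\<^sub>1 ((\<lambda>u. F\<^sub>1 u - F\<^sub>2 u) (C\<^sub>1 u) + F\<^sub>2 ((\<lambda>u. C\<^sub>1 u - C\<^sub>2 u) u)))"
      by (rule arg_cong[where f = norm]) (simp add: post_cov_def lin[OF K] lin[OF F2])
    also have "\<dots> \<le> a * norm u + ?c * (onorm (\<lambda>u. F\<^sub>2 (C\<^sub>2 u)) * norm u)
        + onorm (gain \<Gamma> C\<^sub>1 F\<^sub>1 A\<^sub>1) * (b * (onorm C\<^sub>1 * norm u) + onorm F\<^sub>2 * (a * norm u))"
    proof (intro norm_triangle_mono)
      show "norm (C\<^sub>1 u - C\<^sub>2 u) \<le> a * norm u"
        unfolding a_def by (rule onorm[OF dC])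
      have "norm (gain \<Gamma> C\<^sub>1 F\<^sub>1 A\<^sub>1 (F\<^sub>2 (C\<^sub>2 u)) - gain \<Gamma> C\<^sub>2 F\<^sub>2 A\<^sub>2 (F\<^sub>2 (C\<^sub>2 u)))
          \<le> ?c * norm (F\<^sub>2 (C\<^sub>2 u))"
        unfolding a_def b_def by (rule gain_perturbation[OF \<Gamma> C1 C2 F1 adj1 F2 adj2])
      also have "\<dots> \<le> ?c * (onorm (\<lambda>u. F\<^sub>2 (C\<^sub>2 u)) * norm u)"
        by (intro mult_left_mono c onorm[OF FC])
      finally show "norm (- (gain \<Gamma> C\<^sub>1 F\<^sub>1 A\<^sub>1 (F\<^sub>2 (C\<^sub>2 u)) - gain \<Gamma> C\<^sub>2 F\<^sub>2 A\<^sub>2 (F\<^sub>2 (C\<^sub>2 u))))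
          \<le> ?c * (onorm (\<lambda>u. F\<^sub>2 (C\<^sub>2 u)) * norm u)"
        by (simp only: norm_minus_cancel)
      show "norm (- gain \<Gamma> C\<^sub>1 F\<^sub>1 A\<^sub>1 (F\<^sub>1 (C\<^sub>1 u) - F\<^sub>2 (C\<^sub>1 u) + F\<^sub>2 (C\<^sub>1 u - C\<^sub>2 u)))
          \<le> onorm (gain \<Gamma> C\<^sub>1 F\<^sub>1 A\<^sub>1) * (b * (onorm C\<^sub>1 * norm u) + onorm F\<^sub>2 * (a * norm u))"
        unfolding norm_minus_cancel
        using onorm_le_mult[OF dF onorm[OF C1(1), of u]] onorm_le_mult[OF F2 onorm[OF dC, of u]]
        by (intro onorm_le_mult[OF K] norm_triangle_mono) (simp_all add: a_def b_def)
    qed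
    also have "\<dots> = ?R * norm u" by (simp only: distrib_left distrib_right mult.assoc)
    finally show "norm (post_cov \<Gamma> C\<^sub>1 F\<^sub>1 A\<^sub>1 u - post_cov \<Gamma> C\<^sub>2 F\<^sub>2 A\<^sub>2 u) \<le> ?R * norm u" .
  qed
qed

section \<open>Riesz representation and orthogonal projection\<close>

text \<open>The representing vector minimises \<open>\<parallel>u\<parallel>\<^sup>2 - 2 f u\<close>; minimising sequences are Cauchy by the
  parallelogram law.\<close>

lemma riesz_representation:
  fixes f :: "'h::{real_inner, complete_space} \<Rightarrow> real"
  assumes f: "bounded_linear f"
  shows "\<exists>v. \<forall>u. f u = u \<bullet> v"
proof -
  interpret f: bounded_linear f by fact
  define J where "J u = (norm u)\<^sup>2 - 2 * f u" for u
  have "- (onorm f)\<^sup>2 \<le> J u" for u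
  proof -
    have "f u \<le> onorm f * norm u" using onorm[OF f, of u] by simp
    moreover have "0 \<le> (norm u - onorm f)\<^sup>2" by simp
    ultimately show ?thesis by (simp add: J_def power2_diff mult_ac)
  qed
  then have bdd: "bdd_below (range J)" by (intro bdd_belowI) auto
  define m where "m = Inf (range J)"
  have m: "m \<le> J u" for u unfolding m_def by (intro cInf_lower bdd) auto
  \<comment> \<open>The linear parts cancel because \<open>f\<close> at the midpoint is the mean of
    \<open>f x\<close> and \<open>f y\<close>; the midpoint value of \<open>J\<close> is at least
    \<open>m\<close>.\<close>
  have para: "(norm (x - y))\<^sup>2 \<le> 2 * (J x - m) + 2 * (J y - m)" for x y
  proof -
    have "(norm (x - y))\<^sup>2 = 2 * J x + 2 * J y - 4 * J ((1 / 2) *\<^sub>R (x + y))"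
      unfolding J_def power2_norm_eq_inner
      by (simp add: inner_add inner_diff inner_commute f.add f.scaleR algebra_simps)
    then show ?thesis using m[of "(1 / 2) *\<^sub>R (x + y)"] by simp
  qed
  have "\<exists>x. J x < m + inverse (real (Suc n))" for n
    using cInf_lessD[of "range J" "m + inverse (real (Suc n))"] by (auto simp: m_def)
  then obtain x where x: "\<And>n. J (x n) < m + inverse (real (Suc n))" by metis
  have "Cauchy x"
  proof (rule CauchyI')
    fix e :: real assume e: "0 < e"
    \<comment> \<open>Two values of \<open>J\<close> below \<open>m + e\<^sup>2 / 4\<close> make the
      right-hand side of \<open>para\<close> less than \<open>e\<^sup>2\<close>.\<close>
    then obtain M where M: "inverse (real (Suc M)) < e\<^sup>2 / 4"
      using reals_Archimedean[of "e\<^sup>2 / 4"] by auto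
    have J: "J (x k) < m + e\<^sup>2 / 4" if "M \<le> k" for k
    proof -
      have "J (x k) < m + inverse (real (Suc k))" by (rule x)
      also have "\<dots> \<le> m + inverse (real (Suc M))" using that by simp
      also have "\<dots> < m + e\<^sup>2 / 4" using M by simp
      finally show ?thesis .
    qed
    show "\<exists>M. \<forall>p\<ge>M. \<forall>n>p. dist (x p) (x n) < e"
    proof (intro exI allI impI)
      fix p n assume "M \<le> p" "p < n"
      with para[of "x p" "x n"] J[of p] J[of n]
      have "(norm (x p - x n))\<^sup>2 < e\<^sup>2" by simp
      then show "dist (x p) (x n) < e" using e by (simp add: dist_norm power2_less_imp_less)
    qed
  qed
  then obtain v where v: "x \<longlonglongrightarrow> v" using Cauchy_convergent convergent_def by blast
  have "(\<lambda>n. J (x n)) \<longlonglongrightarrow> J v"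
    unfolding J_def by (intro tendsto_intros f.tendsto v)
  moreover have "(\<lambda>n. m + inverse (real (Suc n))) \<longlonglongrightarrow> m + 0"
    by (intro tendsto_intros LIMSEQ_inverse_real_of_nat)
  ultimately have "J v \<le> m + 0"
    by (rule LIMSEQ_le) (meson x less_imp_le)
  then have Jv: "J v \<le> m" by simp
  have "f u = u \<bullet> v" for u
  proof (cases "u = 0")
    case False
    define d where "d = u \<bullet> v - f u"
    \<comment> \<open>This \<open>t\<close> minimises the quadratic
      \<open>t\<^sup>2 * (u \<bullet> u) + 2 * t * d\<close>; a nonzero \<open>d\<close> would push
      \<open>J\<close> below its minimum.\<close>
    define t where "t = - d / (u \<bullet> u)"
    have uu: "0 < u \<bullet> u" using False by simp
    have "J v \<le> J (v + t *\<^sub>R u)" using Jv m order_trans by blast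
    also have "\<dots> = J v + t\<^sup>2 * (u \<bullet> u) + 2 * t * d"
      unfolding J_def power2_norm_eq_inner d_def
      by (simp add: inner_add inner_commute f.add f.scaleR algebra_simps power2_eq_square)
    also have "\<dots> = J v - d\<^sup>2 / (u \<bullet> u)"
      using uu by (simp add: t_def power2_eq_square field_simps)
    finally have "d\<^sup>2 / (u \<bullet> u) \<le> 0" by simp
    then have "d = 0" using uu by (simp add: divide_le_0_iff)
    then show ?thesis by (simp add: d_def)
  qed (simp add: f.zero)
  then show ?thesis by blast
qed

text \<open>Since \<open>adjoint\<close> is a choice operator, its property needs a witness: the
  Riesz vectors of the finitely many components of \<open>F\<close>, combined with the entries of
  \<open>z\<close> as weights.\<close>

lemma adjoint_hilbert:
  fixes F :: "'h::{real_inner, complete_space} \<Rightarrow> real ^ 'd"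
  assumes F: "bounded_linear F"
  shows "F u \<bullet> z = u \<bullet> adjoint F z"
proof -
  have "\<exists>v. \<forall>u. F u $ a = u \<bullet> v" for a
    by (intro riesz_representation bounded_linear_compose[OF bounded_linear_vec_nth F])
  then obtain v where v: "\<And>a u. F u $ a = u \<bullet> v a" by metis
  have "\<exists>A. \<forall>u z. F u \<bullet> z = u \<bullet> A z"
    by (rule exI[of _ "\<lambda>z. \<Sum>a\<in>UNIV. z $ a *\<^sub>R v a"])
      (simp add: inner_vec_def v inner_sum_right mult.commute)
  then show ?thesis unfolding adjoint_def by (rule someI2_ex) simp
qed

section \<open>Finite-dimensional projections and biorthogonal bases\<close>

lemma orth_proj_exists:
  fixes B :: "'h::real_inner set"
  assumes "finite B"
  obtains v where "v \<in> span B" "\<And>w. w \<in> span B \<Longrightarrow> (u - v) \<bullet> w = 0"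
proof -
  obtain D where D: "finite D" "span D = span B" "pairwise orthogonal D"
    using basis_orthogonal[OF assms] by blast
  \<comment> \<open>Fourier sum over an orthogonal spanning set. A zero vector in \<open>D\<close>
    is harmless, since division by zero yields zero.\<close>
  define v where "v = (\<Sum>c\<in>D. ((u \<bullet> c) / (c \<bullet> c)) *\<^sub>R c)"
  have "v \<in> span D" unfolding v_def by (intro span_sum span_scale span_base)
  moreover have "(u - v) \<bullet> w = 0" if "w \<in> span D" for w
    using that
  proof (induction rule: span_induct_alt)
    case (step r x y)
    have "v \<bullet> x = (\<Sum>c\<in>D. if c = x then u \<bullet> x else 0)"
      unfolding v_def inner_sum_left
      using D(3) step.hyps by (intro sum.cong) (auto simp: pairwise_def orthogonal_def)
    also have "\<dots> = u \<bullet> x" using D(1) step.hyps by simp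
    finally show ?case using step.IH by (simp add: inner_add_right inner_diff_left)
  qed simp
  ultimately show thesis using that D(2) by blast
qed

text \<open>Orthogonality to the generators extends to the span by linearity. Two candidates differ
  by a vector of the span that is orthogonal to itself.\<close>

lemma orth_proj_eqI:
  assumes "v \<in> span B" "\<And>w. w \<in> B \<Longrightarrow> (u - v) \<bullet> w = 0"
  shows "orth_proj (span B) u = v"
  unfolding orth_proj_def
proof (rule the_equality)
  have *: "(u - v) \<bullet> w = 0" if "w \<in> span B" for w
    using that by (induction rule: span_induct_alt) (auto simp: inner_add_right assms(2))
  show "v \<in> span B \<and> (\<forall>w\<in>span B. (u - v) \<bullet> w = 0)" using assms(1) * by blast
  fix v' assume v': "v' \<in> span B \<and> (\<forall>w\<in>span B. (u - v') \<bullet> w = 0)"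
  then have "v - v' \<in> span B" using assms(1) by (blast intro: span_diff)
  then have "(u - v') \<bullet> (v - v') - (u - v) \<bullet> (v - v') = 0" using * v' by simp
  then have "(v - v') \<bullet> (v - v') = 0" by (simp add: inner_diff_left)
  then show "v' = v" by simp
qed

text \<open>Take the component of \<open>\<phi> i\<close> orthogonal to the other basis vectors.
  Independence makes it nonzero, so it can be scaled to pair to 1 with
  \<open>\<phi> i\<close>.\<close>

lemma dual_basis_exists:
  fixes \<phi> :: "nat \<Rightarrow> 'h::real_inner"
  assumes inj: "inj_on \<phi> {..<n}" and ind: "independent (\<phi> ` {..<n})"
  obtains d where "\<And>i. i < n \<Longrightarrow> d i \<in> span (\<phi> ` {..<n})"
    "\<And>i j. i < n \<Longrightarrow> j < n \<Longrightarrow> d i \<bullet> \<phi> j = of_bool (i = j)"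
proof -
  have "\<exists>d. d \<in> span (\<phi> ` {..<n}) \<and> (\<forall>j<n. d \<bullet> \<phi> j = of_bool (i = j))" if i: "i < n" for i
  proof -
    let ?B = "\<phi> ` {..<n} - {\<phi> i}"
    obtain v where v: "v \<in> span ?B" "\<And>w. w \<in> span ?B \<Longrightarrow> (\<phi> i - v) \<bullet> w = 0"
      using orth_proj_exists[of ?B "\<phi> i"] by auto
    define e where "e = \<phi> i - v"
    have "\<phi> i \<notin> span ?B" using ind i unfolding dependent_def by blast
    then have "e \<noteq> 0" using v(1) by (auto simp: e_def)
    have e: "e \<bullet> \<phi> i = e \<bullet> e"
      using v by (simp add: e_def inner_diff_right)
    have "e \<in> span (\<phi> ` {..<n})"
      unfolding e_def using i v(1) span_mono[of ?B "\<phi> ` {..<n}"]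
      by (intro span_diff) (auto intro: span_base)
    moreover have "e \<bullet> \<phi> j = 0" if "j < n" "j \<noteq> i" for j
      unfolding e_def using that inj i by (intro v(2) span_base) (auto dest: inj_onD)
    ultimately show ?thesis
      using e \<open>e \<noteq> 0\<close> by (intro exI[of _ "e /\<^sub>R (e \<bullet> e)"]) (auto intro: span_scale)
  qed
  then show thesis using that by metis
qed

section \<open>Lifting the discretized posterior\<close>

text \<open>In terms of the biorthogonal basis \<open>d\<close> of the same subspace, the coefficients of the projection
  of \<open>u\<close> are \<open>d i \<bullet> u\<close>, and the inverse of the mass matrix is the Gram matrix of \<open>d\<close>.\<close>

locale dual_basis =
  fixes \<phi> :: "nat \<Rightarrow> 'h::real_inner" and n :: nat and d :: "nat \<Rightarrow> 'h"
  assumes in_span: "i < n \<Longrightarrow> d i \<in> span (\<phi> ` {..<n})"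
    and dual: "i < n \<Longrightarrow> j < n \<Longrightarrow> d i \<bullet> \<phi> j = of_bool (i = j)"
begin

text \<open>The defect lies in the span and is orthogonal to every basis vector, hence to
  itself.\<close>

lemma expansion:
  assumes v: "v \<in> span (\<phi> ` {..<n})"
  shows "(\<Sum>i<n. (v \<bullet> \<phi> i) *\<^sub>R d i) = v"
proof -
  define w where "w = v - (\<Sum>i<n. (v \<bullet> \<phi> i) *\<^sub>R d i)"
  have w: "w \<in> span (\<phi> ` {..<n})"
    unfolding w_def using v by (intro span_diff span_sum span_scale in_span) auto
  have perp: "w \<bullet> \<phi> k = 0" if "k < n" for k
  proof -
    have "(\<Sum>i<n. (v \<bullet> \<phi> i) * (d i \<bullet> \<phi> k)) = (\<Sum>i<n. if i = k then v \<bullet> \<phi> k else 0)"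
      using that by (intro sum.cong) (auto simp: dual)
    then show ?thesis using that by (simp add: w_def inner_diff_left inner_sum_left)
  qed
  have "w \<bullet> x = 0" if "x \<in> span (\<phi> ` {..<n})" for x
    using that by (induction rule: span_induct_alt) (auto simp: inner_add_right perp)
  from this[OF w] have "w \<bullet> w = 0" .
  then show ?thesis by (simp add: w_def)
qed

text \<open>These are the normal equations of the projection, obtained by pairing the expansion of
  \<open>\<phi> k\<close> with \<open>u\<close>.\<close>

lemma inner_basis: "k < n \<Longrightarrow> \<phi> k \<bullet> u = (\<Sum>i<n. (\<phi> k \<bullet> \<phi> i) * (d i \<bullet> u))"
proof -
  assume "k < n"
  then have "\<phi> k \<in> span (\<phi> ` {..<n})" by (intro span_base) auto
  from arg_cong[where f = "\<lambda>v. v \<bullet> u", OF expansion[OF this]] show ?thesis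
    by (simp add: inner_sum_left)
qed

lemma orth_proj: "orth_proj (span (\<phi> ` {..<n})) u = Pstar \<phi> n (\<lambda>i. d i \<bullet> u)"
proof (rule orth_proj_eqI)
  show "Pstar \<phi> n (\<lambda>i. d i \<bullet> u) \<in> span (\<phi> ` {..<n})"
    unfolding Pstar_def by (intro span_sum span_scale span_base) auto
  fix w assume "w \<in> \<phi> ` {..<n}"
  then obtain k where "k < n" "w = \<phi> k" by auto
  then show "(u - Pstar \<phi> n (\<lambda>i. d i \<bullet> u)) \<bullet> w = 0"
    using inner_basis[of k u]
    by (simp add: Pstar_def inner_diff_left inner_diff_right inner_sum_left inner_sum_right
        inner_commute mult.commute)
qed

lemma dual_Pstar: "i < n \<Longrightarrow> d i \<bullet> Pstar \<phi> n c = c i"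
proof -
  assume i: "i < n"
  have "(\<Sum>j<n. c j * (d i \<bullet> \<phi> j)) = (\<Sum>j<n. if j = i then c i else 0)"
    using i by (intro sum.cong) (auto simp: dual)
  then show ?thesis using i by (simp add: Pstar_def inner_sum_right)
qed

text \<open>Pairing with \<open>d i\<close> recovers the coefficient of index \<open>i\<close>, and
  the entries from \<open>n\<close> on are fixed to zero; so the description in \<open>Pcoef\<close>
  has a unique solution.\<close>

lemma Pcoef: "Pcoef \<phi> n u = (\<lambda>i. if i < n then d i \<bullet> u else 0)"
  unfolding Pcoef_def orth_proj
proof (rule the_equality)
  show "(\<forall>i\<ge>n. (if i < n then d i \<bullet> u else 0) = 0) \<and>
    Pstar \<phi> n (\<lambda>i. if i < n then d i \<bullet> u else 0) = Pstar \<phi> n (\<lambda>i. d i \<bullet> u)"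
    by (simp add: Pstar_def)
  fix c assume "(\<forall>i\<ge>n. c i = 0) \<and> Pstar \<phi> n c = Pstar \<phi> n (\<lambda>i. d i \<bullet> u)"
  then show "c = (\<lambda>i. if i < n then d i \<bullet> u else 0)"
    using dual_Pstar[of _ c] dual_Pstar[of _ "\<lambda>i. d i \<bullet> u"] by fastforce
qed

lemma Pcoef_Pstar: "(\<And>i. n \<le> i \<Longrightarrow> c i = 0) \<Longrightarrow> Pcoef \<phi> n (Pstar \<phi> n c) = c"
  by (auto simp: Pcoef dual_Pstar)

lemma Pstar_inner: "Pstar \<phi> n c \<bullet> u = mass_inner \<phi> n c (Pcoef \<phi> n u)"
  by (simp add: Pstar_def mass_inner_def mass_def Pcoef inner_sum_left inner_basis[of _ u]
      sum_distrib_left mult.assoc)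

text \<open>Each \<open>d j\<close> is its own projection, so its basis coefficients are the Gram
  entries \<open>d i \<bullet> d j\<close>. This evaluates the inverse mass matrix inside the lifted
  adjoint.\<close>

lemma Pstar_gram:
  "Pstar \<phi> n (\<lambda>i. if i < n then \<Sum>j<n. (d i \<bullet> d j) * w j else 0) = (\<Sum>j<n. w j *\<^sub>R d j)"
proof -
  have "d j = Pstar \<phi> n (\<lambda>i. d i \<bullet> d j)" if "j < n" for j
  proof -
    have "orth_proj (span (\<phi> ` {..<n})) (d j) = d j"
      using that by (intro orth_proj_eqI in_span) auto
    then show ?thesis by (simp add: orth_proj)
  qed
  then have "(\<Sum>j<n. w j *\<^sub>R d j) = (\<Sum>j<n. w j *\<^sub>R Pstar \<phi> n (\<lambda>i. d i \<bullet> d j))" by simp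
  also have "\<dots> = (\<Sum>i<n. \<Sum>j<n. ((d i \<bullet> d j) * w j) *\<^sub>R \<phi> i)"
    by (subst sum.swap) (simp add: Pstar_def scaleR_sum_right mult.commute)
  finally show ?thesis by (simp add: Pstar_def scaleR_sum_left)
qed

text \<open>The normal equations at \<open>u = d j\<close> show that the Gram matrix is a right
  inverse, and symmetry makes it a left one. Uniqueness is the usual associativity argument for a
  left and a right inverse.\<close>

lemma mat_inverse_mass:
  "mat_inverse_n n (mass \<phi>) = (\<lambda>i j. if i < n \<and> j < n then d i \<bullet> d j else 0)" (is "_ = ?D")
proof -
  have MD: "(\<Sum>k<n. mass \<phi> i k * ?D k j) = of_bool (i = j)" if "i < n" "j < n" for i j
    using inner_basis[OF that(1), of "d j"] dual[OF that(2,1)] that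
    by (simp add: mass_def inner_commute eq_commute)
  have DM: "(\<Sum>k<n. ?D i k * mass \<phi> k j) = of_bool (i = j)" if "i < n" "j < n" for i j
    using MD[OF that(2,1)] that by (simp add: mass_def inner_commute mult.commute eq_commute)
  show ?thesis
    unfolding mat_inverse_n_def
  proof (rule the_equality)
    show "(\<forall>i j. n \<le> i \<or> n \<le> j \<longrightarrow> ?D i j = 0) \<and>
      (\<forall>i<n. \<forall>j<n. (\<Sum>k<n. mass \<phi> i k * ?D k j) = of_bool (i = j) \<and>
        (\<Sum>k<n. ?D i k * mass \<phi> k j) = of_bool (i = j))"
      using MD DM by auto
    fix B assume B: "(\<forall>i j. n \<le> i \<or> n \<le> j \<longrightarrow> B i j = 0) \<and>
      (\<forall>i<n. \<forall>j<n. (\<Sum>k<n. mass \<phi> i k * B k j) = of_bool (i = j) \<and>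
        (\<Sum>k<n. B i k * mass \<phi> k j) = of_bool (i = j))"
    have "B i j = ?D i j" if ij: "i < n" "j < n" for i j
    proof -
      have "B i j = (\<Sum>k<n. B i k * of_bool (k = j))"
        using ij by (simp add: of_bool_def if_distrib cong: if_cong)
      also have "\<dots> = (\<Sum>k<n. B i k * (\<Sum>l<n. mass \<phi> k l * ?D l j))"
        using MD ij by (intro sum.cong) auto
      also have "\<dots> = (\<Sum>l<n. (\<Sum>k<n. B i k * mass \<phi> k l) * ?D l j)"
        unfolding sum_distrib_left sum_distrib_right by (subst sum.swap) (simp only: mult.assoc)
      also have "\<dots> = (\<Sum>l<n. of_bool (i = l) * ?D l j)"
        using B ij by (intro sum.cong) auto
      also have "\<dots> = ?D i j"
        using ij by (simp add: of_bool_def if_distrib if_distribR cong: if_cong)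
      finally show ?thesis .
    qed
    then show "B = ?D" using B by (intro ext) (auto simp: not_less)
  qed
qed

section \<open>Lifted operators and the lifted posterior\<close>

lemma fwd_adjoint: "fwd n A (Pcoef \<phi> n u) \<bullet> z = u \<bullet> Pstar \<phi> n (fwd_nat \<phi> n A z)"
proof -
  have "Pstar \<phi> n (fwd_nat \<phi> n A z)
      = Pstar \<phi> n (\<lambda>i. if i < n then \<Sum>j<n. (d i \<bullet> d j) * (\<Sum>a\<in>UNIV. A a j * z $ a) else 0)"
    by (intro arg_cong[where f = "Pstar \<phi> n"])
      (auto simp: fwd_nat_def mat_vec_def mat_inverse_mass)
  then have "u \<bullet> Pstar \<phi> n (fwd_nat \<phi> n A z) = (\<Sum>j<n. \<Sum>a\<in>UNIV. A a j * z $ a * (u \<bullet> d j))"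
    by (simp add: Pstar_gram inner_sum_right sum_distrib_right)
  also have "\<dots> = fwd n A (Pcoef \<phi> n u) \<bullet> z"
    by (subst sum.swap)
      (simp add: fwd_def Pcoef inner_vec_def sum_distrib_left inner_commute mult_ac)
  finally show ?thesis by simp
qed

lemma fwd_Pcoef_Pstar: "fwd n A (Pcoef \<phi> n (Pstar \<phi> n c)) = fwd n A c"
  by (simp add: fwd_def Pcoef dual_Pstar)

text \<open>The map is a finite sum of rank-one operators built from the functionals
  \<open>u \<bullet> d j\<close>.\<close>

lemma bounded_linear_fwd_Pcoef: "bounded_linear (\<lambda>u. fwd n A (Pcoef \<phi> n u) :: real ^ 'd)"
proof -
  have *: "(\<lambda>u. fwd n A (Pcoef \<phi> n u) :: real ^ 'd)
      = (\<lambda>u. \<Sum>j<n. (u \<bullet> d j) *\<^sub>R (\<chi> a. A a j))"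
    by (auto simp: fwd_def Pcoef vec_eq_iff inner_commute mult.commute intro!: ext sum.cong)
  show ?thesis
    unfolding * by (intro bounded_linear_sum bounded_linear_compose[OF bounded_linear_scaleR_left]
        bounded_linear_inner_left)
qed

lemma bounded_linear_mat_vec: "bounded_linear (\<lambda>u. Pstar \<phi> n (mat_vec n C (Pcoef \<phi> n u)))"
proof -
  have *: "(\<lambda>u. Pstar \<phi> n (mat_vec n C (Pcoef \<phi> n u)))
      = (\<lambda>u. \<Sum>i<n. \<Sum>j<n. (u \<bullet> d j) *\<^sub>R (C i j *\<^sub>R \<phi> i))"
    by (auto simp: Pstar_def mat_vec_def Pcoef inner_commute mult.commute scaleR_sum_left
        intro!: ext sum.cong)
  show ?thesis
    unfolding * by (intro bounded_linear_sum bounded_linear_compose[OF bounded_linear_scaleR_left]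
        bounded_linear_inner_left)
qed

lemma mat_vec_nonneg:
  assumes "mass_spd \<phi> n C"
  shows "0 \<le> Pstar \<phi> n (mat_vec n C (Pcoef \<phi> n u)) \<bullet> u"
proof -
  have "Pstar \<phi> n (mat_vec n C (Pcoef \<phi> n u)) \<bullet> u
      = mass_inner \<phi> n (Pcoef \<phi> n u) (mat_vec n C (Pcoef \<phi> n u))"
    using assms by (simp add: Pstar_inner mass_spd_def)
  also have "\<dots> \<ge> 0"
  \<comment> \<open>\<open>mass_spd\<close> gives positivity only for vectors with a nonzero entry
    below \<open>n\<close>; without one, every summand of the form vanishes.\<close>
  proof (cases "\<exists>i<n. Pcoef \<phi> n u i \<noteq> 0")
    case True
    then show ?thesis using assms by (simp add: mass_spd_def less_imp_le)
  qed (simp add: mass_inner_def)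
  finally show ?thesis .
qed

text \<open>Each composite of \<open>Pcoef\<close> after \<open>Pstar\<close> cancels, so the lifted
  and the discrete formula invert the same map on the data space.\<close>

lemma post_cov_lift:
  fixes \<Gamma> :: "real ^ 'd ^ 'd"
  shows "Pstar \<phi> n (post_cov \<Gamma> (mat_vec n C) (fwd n A) (fwd_nat \<phi> n A) (Pcoef \<phi> n u))
    = post_cov \<Gamma> (\<lambda>u. Pstar \<phi> n (mat_vec n C (Pcoef \<phi> n u))) (\<lambda>u. fwd n A (Pcoef \<phi> n u))
        (\<lambda>z. Pstar \<phi> n (fwd_nat \<phi> n A z)) u"
proof -
  have diff: "Pstar \<phi> n (x - y) = Pstar \<phi> n x - Pstar \<phi> n y" for x y
    by (simp add: Pstar_def scaleR_diff_left sum_subtractf)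
  have nat: "Pcoef \<phi> n (Pstar \<phi> n (fwd_nat \<phi> n A z)) = fwd_nat \<phi> n A z" for z
    by (rule Pcoef_Pstar) (simp add: fwd_nat_def mat_vec_def)
  show ?thesis
    by (simp add: post_cov_def gain_def diff nat fwd_Pcoef_Pstar)
qed

end

section \<open>The error bound\<close>

text \<open>The bound is asserted for all large \<open>n\<close>: the factors 2 are available once
  the errors are small relative to the norms of \<open>\<F>\<close> and of \<open>\<F>\<close> after
  \<open>\<C>\<^sub>0\<close>, which \<open>nondegenerate\<close> makes positive.\<close>

theorem theorem3p4:
  fixes \<F> :: "'h::{real_inner, complete_space} \<Rightarrow> real ^ 'd"
    and \<Gamma> :: "real ^ 'd ^ 'd"
    and \<C>\<^sub>0 :: "'h \<Rightarrow> 'h"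
    and m\<^sub>0 :: 'h
    and \<phi> :: "nat \<Rightarrow> nat \<Rightarrow> 'h"
    and F :: "nat \<Rightarrow> 'd \<Rightarrow> nat \<Rightarrow> real"
    and C\<^sub>0 :: "nat \<Rightarrow> nat \<Rightarrow> nat \<Rightarrow> real"
    and \<iota> :: "'k::{real_inner, complete_space} \<Rightarrow> 'h"
    and r\<^sub>1 r\<^sub>2 r\<^sub>3 :: real
    and \<psi>\<^sub>1 \<psi>\<^sub>2 \<psi>\<^sub>3 :: "nat \<Rightarrow> real"
  assumes infinite_dimensional: "\<nexists>B :: 'h set. finite B \<and> span B = UNIV"
    and separable: "\<exists>D :: 'h set. countable D \<and> closure D = UNIV"
    and forward: "bounded_linear \<F>"
    and noise: "spd_matrix \<Gamma>"
    and prior_cov: "covariance_op \<C>\<^sub>0"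
    and prior_mean: "m\<^sub>0 \<in> range (op_sqrt \<C>\<^sub>0)"
    and basis: "\<And>n. n \<ge> 1 \<Longrightarrow> inj_on (\<phi> n) {..<n} \<and> independent (\<phi> n ` {..<n})"
    and discrete_prior_cov: "\<And>n. n \<ge> 1 \<Longrightarrow> mass_spd (\<phi> n) n (C\<^sub>0 n)"
    and psi1: "\<psi>\<^sub>1 \<longlonglongrightarrow> 0"
    and err1: "\<And>n. n \<ge> 1 \<Longrightarrow>
      onorm (\<lambda>u. \<C>\<^sub>0 u - Pstar (\<phi> n) n (mat_vec n (C\<^sub>0 n) (Pcoef (\<phi> n) n u))) \<le> r\<^sub>1 * \<psi>\<^sub>1 n"
    and psi2: "\<psi>\<^sub>2 \<longlonglongrightarrow> 0"
    and err2: "\<And>n. n \<ge> 1 \<Longrightarrow>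
      onorm (\<lambda>u. \<F> u - fwd n (F n) (Pcoef (\<phi> n) n u)) \<le> r\<^sub>2 * \<psi>\<^sub>2 n"
    and embedding: "bounded_linear \<iota>" "inj \<iota>"
    and psi3: "\<psi>\<^sub>3 \<longlonglongrightarrow> 0"
    and err3: "\<And>n u. n \<ge> 1 \<Longrightarrow>
      norm (\<iota> u - Pstar (\<phi> n) n (Pcoef (\<phi> n) n (\<iota> u))) \<le> r\<^sub>3 * \<psi>\<^sub>3 n * norm u"
    and nondegenerate: "\<exists>u. \<F> (\<C>\<^sub>0 u) \<noteq> 0"
  shows "\<forall>\<^sub>F n in sequentially.
    (let F\<^sub>2 = (\<lambda>u. fwd n (F n) (Pcoef (\<phi> n) n u));
         c\<^sub>1 = c1_const \<Gamma> \<C>\<^sub>0 \<F> F\<^sub>2;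
         c\<^sub>2 = c2_const \<Gamma> \<C>\<^sub>0 \<F> F\<^sub>2;
         K = gain \<Gamma> \<C>\<^sub>0 \<F> (adjoint \<F>);
         r\<^sub>1' = r\<^sub>1 + 2 * c\<^sub>1 * r\<^sub>1 * onorm \<F> * onorm \<C>\<^sub>0 + 2 * r\<^sub>1 * onorm \<F> * onorm K;
         r\<^sub>2' = 2 * c\<^sub>2 * r\<^sub>2 * onorm (\<lambda>u. \<F> (\<C>\<^sub>0 u)) + r\<^sub>2 * onorm \<C>\<^sub>0 * onorm K;
         \<epsilon>\<^sub>C = onorm (\<lambda>u. post_cov \<Gamma> \<C>\<^sub>0 \<F> (adjoint \<F>) u
           - Pstar (\<phi> n) n
               (post_cov \<Gamma> (mat_vec n (C\<^sub>0 n)) (fwd n (F n)) (fwd_nat (\<phi> n) n (F n))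
                 (Pcoef (\<phi> n) n u)))
     in \<epsilon>\<^sub>C \<le> r\<^sub>1' * \<psi>\<^sub>1 n + r\<^sub>2' * \<psi>\<^sub>2 n)"
proof -
  let ?F2 = "\<lambda>n u. fwd n (F n) (Pcoef (\<phi> n) n u)"
  let ?C2 = "\<lambda>n u. Pstar (\<phi> n) n (mat_vec n (C\<^sub>0 n) (Pcoef (\<phi> n) n u))"
  let ?K = "gain \<Gamma> \<C>\<^sub>0 \<F> (adjoint \<F>)" and ?FC = "\<lambda>u. \<F> (\<C>\<^sub>0 u)"
  let ?a = "\<lambda>n. onorm (\<lambda>u. \<C>\<^sub>0 u - ?C2 n u)" and ?b = "\<lambda>n. onorm (\<lambda>u. \<F> u - ?F2 n u)"
  have C: "bounded_linear \<C>\<^sub>0" "\<And>u. 0 \<le> \<C>\<^sub>0 u \<bullet> u"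
    using prior_cov by (auto simp: covariance_op_def nonneg_op_def self_adjoint_op_def)
  have K: "bounded_linear ?K"
    by (rule gain_bounded_linear[OF noise C forward adjoint_hilbert[OF forward]])
  have FC: "bounded_linear ?FC" by (rule bounded_linear_compose[OF forward C(1)])
  obtain u where u: "\<F> (\<C>\<^sub>0 u) \<noteq> 0" using nondegenerate by blast
  have FC_pos: "0 < onorm ?FC"
    using u onorm_pos_lt[OF FC] by auto
  have F_pos: "0 < onorm \<F>"
    using u onorm_pos_lt[OF forward] by auto
  have p: "(\<lambda>n. r\<^sub>1 * \<psi>\<^sub>1 n) \<longlonglongrightarrow> 0" and q: "(\<lambda>n. r\<^sub>2 * \<psi>\<^sub>2 n) \<longlonglongrightarrow> 0"
    using tendsto_mult_right_zero[OF psi1] tendsto_mult_right_zero[OF psi2] by auto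
  \<comment> \<open>This sequence will dominate the norm of the difference between
    \<open>\<F>\<close> after \<open>\<C>\<^sub>0\<close> and its discretization; the factor 2
    anticipates the bound \<open>F2_le\<close>.\<close>
  have "(\<lambda>n. r\<^sub>2 * \<psi>\<^sub>2 n * onorm \<C>\<^sub>0 + 2 * onorm \<F> * (r\<^sub>1 * \<psi>\<^sub>1 n)) \<longlonglongrightarrow> 0 * onorm \<C>\<^sub>0 + 2 * onorm \<F> * 0"
    by (intro tendsto_intros p q)
  then have "\<forall>\<^sub>F n in sequentially. r\<^sub>2 * \<psi>\<^sub>2 n * onorm \<C>\<^sub>0 + 2 * onorm \<F> * (r\<^sub>1 * \<psi>\<^sub>1 n) < onorm ?FC"
    using FC_pos by (auto dest: order_tendstoD)
  moreover have "\<forall>\<^sub>F n in sequentially. r\<^sub>2 * \<psi>\<^sub>2 n < onorm \<F>"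
    using q F_pos by (rule order_tendstoD)
  ultimately show ?thesis
    using eventually_ge_at_top[of 1]
  proof eventually_elim
    case (elim n)
    obtain d where "dual_basis (\<phi> n) n d"
      using dual_basis_exists[of "\<phi> n" n] basis[OF elim(3)] unfolding dual_basis_def by metis
    then interpret dual_basis "\<phi> n" n d .
    note F2 = bounded_linear_fwd_Pcoef[of "F n"] and C2 = bounded_linear_mat_vec[of "C\<^sub>0 n"]
    note lin = bounded_linear.linear[THEN linear_diff]
    have dC: "bounded_linear (\<lambda>u. \<C>\<^sub>0 u - ?C2 n u)" and dF: "bounded_linear (\<lambda>u. \<F> u - ?F2 n u)"
      by (intro bounded_linear_sub C C2 forward F2)+
    have a: "0 \<le> ?a n" "?a n \<le> r\<^sub>1 * \<psi>\<^sub>1 n" using onorm_pos_le[OF dC] err1[OF elim(3)] by auto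
    have b: "0 \<le> ?b n" "?b n \<le> r\<^sub>2 * \<psi>\<^sub>2 n" using onorm_pos_le[OF dF] err2[OF elim(3)] by auto
    \<comment> \<open>The signs of the constants and rates are unrestricted; only their products are
      known to be nonnegative, as upper bounds of operator norms.\<close>
    have p: "0 \<le> r\<^sub>1 * \<psi>\<^sub>1 n" "0 \<le> r\<^sub>2 * \<psi>\<^sub>2 n" using a b by linarith+
    have "onorm (?F2 n) \<le> onorm \<F> + ?b n"
    proof (rule onorm_bound)
      fix v
      have "norm (\<F> v - (\<F> v - ?F2 n v)) \<le> onorm \<F> * norm v + ?b n * norm v"
        by (rule order_trans[OF norm_triangle_ineq4]) (intro add_mono onorm forward onorm[OF dF])
      then show "norm (?F2 n v) \<le> (onorm \<F> + ?b n) * norm v" by (simp add: algebra_simps)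
    qed (use F_pos b in simp)
    then have F2_le: "onorm (?F2 n) \<le> 2 * onorm \<F>" using b elim(2) by linarith
    have "onorm (\<lambda>u. ?F2 n (?C2 n u)) \<le> onorm ?FC + (?b n * onorm \<C>\<^sub>0 + onorm (?F2 n) * ?a n)"
    proof (rule onorm_bound)
      fix v
      have "norm (?FC v - ((\<lambda>u. \<F> u - ?F2 n u) (\<C>\<^sub>0 v) + ?F2 n ((\<lambda>u. \<C>\<^sub>0 u - ?C2 n u) v)))
          \<le> onorm ?FC * norm v + (?b n * (onorm \<C>\<^sub>0 * norm v) + onorm (?F2 n) * (?a n * norm v))"
        using onorm[OF FC, of v] onorm_le_mult[OF dF onorm[OF C(1), of v]]
          onorm_le_mult[OF F2 onorm[OF dC, of v]]
        by - (rule order_trans[OF norm_triangle_ineq4], intro add_mono norm_triangle_mono)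
      then show "norm (?F2 n (?C2 n v))
          \<le> (onorm ?FC + (?b n * onorm \<C>\<^sub>0 + onorm (?F2 n) * ?a n)) * norm v"
        by (simp add: lin[OF F2] algebra_simps)
    qed (intro add_nonneg_nonneg mult_nonneg_nonneg a b onorm_pos_le FC F2 C)
    also have "\<dots> \<le> onorm ?FC + (r\<^sub>2 * \<psi>\<^sub>2 n * onorm \<C>\<^sub>0 + 2 * onorm \<F> * (r\<^sub>1 * \<psi>\<^sub>1 n))"
      using F_pos by (intro add_mono mult_mono a b p F2_le onorm_pos_le F2 C order_refl) auto
    finally have FC2_le: "onorm (\<lambda>u. ?F2 n (?C2 n u)) \<le> 2 * onorm ?FC" using elim(1) by linarith
    have FC_le: "onorm ?FC \<le> onorm \<F> * onorm \<C>\<^sub>0"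
      using onorm_compose[OF forward C(1)] by (simp add: comp_def)
    let ?c1 = "c1_const \<Gamma> \<C>\<^sub>0 \<F> (?F2 n)" and ?c2 = "c2_const \<Gamma> \<C>\<^sub>0 \<F> (?F2 n)"
    note c = c_const_nonneg[OF C(1) forward F2, of \<Gamma>]
    note nn = a(1) b(1) c p onorm_pos_le[OF forward] onorm_pos_le[OF C(1)] onorm_pos_le[OF FC]
      onorm_pos_le[OF K] onorm_pos_le[OF F2]
    have "onorm (\<lambda>u. post_cov \<Gamma> \<C>\<^sub>0 \<F> (adjoint \<F>) u
        - Pstar (\<phi> n) n (post_cov \<Gamma> (mat_vec n (C\<^sub>0 n)) (fwd n (F n)) (fwd_nat (\<phi> n) n (F n))
            (Pcoef (\<phi> n) n u)))
      \<le> ?a n + (?c1 * ?a n + ?c2 * ?b n) * onorm (\<lambda>u. ?F2 n (?C2 n u))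
        + onorm ?K * (?b n * onorm \<C>\<^sub>0 + onorm (?F2 n) * ?a n)"
      unfolding post_cov_lift
      by (rule post_cov_perturbation[OF noise C C2 mat_vec_nonneg[OF discrete_prior_cov[OF elim(3)]]
            forward adjoint_hilbert[OF forward] F2 fwd_adjoint])
    also have "\<dots> \<le> ?a n + (?c1 * ?a n + ?c2 * ?b n) * (2 * onorm ?FC)
        + onorm ?K * (?b n * onorm \<C>\<^sub>0 + 2 * onorm \<F> * ?a n)"
      by (intro add_mono mult_mono FC2_le F2_le order_refl add_nonneg_nonneg mult_nonneg_nonneg nn
          onorm_pos_le[OF bounded_linear_compose[OF F2 C2]]) simp
    also have "\<dots> \<le> r\<^sub>1 * \<psi>\<^sub>1 n + (?c1 * (r\<^sub>1 * \<psi>\<^sub>1 n) + ?c2 * (r\<^sub>2 * \<psi>\<^sub>2 n)) * (2 * onorm ?FC)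
        + onorm ?K * (r\<^sub>2 * \<psi>\<^sub>2 n * onorm \<C>\<^sub>0 + 2 * onorm \<F> * (r\<^sub>1 * \<psi>\<^sub>1 n))"
      by (intro add_mono mult_mono a b order_refl add_nonneg_nonneg mult_nonneg_nonneg nn) simp_all
    \<comment> \<open>The two gain terms are separated because \<open>r\<^sub>1'\<close> contains
      the product of the norms of \<open>\<F>\<close> and \<open>\<C>\<^sub>0\<close>, whereas
      \<open>r\<^sub>2'\<close> keeps the norm of the composite. Only the first is enlarged by
      \<open>FC_le\<close>.\<close>
    also have "\<dots> = r\<^sub>1 * \<psi>\<^sub>1 n + ?c1 * (r\<^sub>1 * \<psi>\<^sub>1 n) * (2 * onorm ?FC)
        + ?c2 * (r\<^sub>2 * \<psi>\<^sub>2 n) * (2 * onorm ?FC)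
        + onorm ?K * (r\<^sub>2 * \<psi>\<^sub>2 n * onorm \<C>\<^sub>0 + 2 * onorm \<F> * (r\<^sub>1 * \<psi>\<^sub>1 n))"
      by (simp add: algebra_simps)
    also have "\<dots> \<le> r\<^sub>1 * \<psi>\<^sub>1 n + ?c1 * (r\<^sub>1 * \<psi>\<^sub>1 n) * (2 * (onorm \<F> * onorm \<C>\<^sub>0))
        + ?c2 * (r\<^sub>2 * \<psi>\<^sub>2 n) * (2 * onorm ?FC)
        + onorm ?K * (r\<^sub>2 * \<psi>\<^sub>2 n * onorm \<C>\<^sub>0 + 2 * onorm \<F> * (r\<^sub>1 * \<psi>\<^sub>1 n))"
      by (intro add_mono mult_left_mono FC_le order_refl mult_nonneg_nonneg nn) simp
    finally show ?case
      by (simp add: Let_def algebra_simps)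
  qed
qed

end
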